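(* There exists a real number $c>1$ such that for every integer $k>1$ and every integer $m>2^{ck}$ the following holds: if $\mathcal{F}$ is a family of sets, each of cardinality $m$, that satisfies the $\Gamma(b)$-condition with $$b = c\, 2^{\frac52\sqrt{\log_2 m}}\left(\sqrt{m}\,\log_2 m\right) k\log_2 k ,$$ then $\mathcal{F}$ includes $k$ mutually disjoint sets.
   Context: All sets are subsets of a finite universal set $X$, and $\mathcal{F}$ is a family of subsets of $X$. For a set $S$, $\mathcal{F}[S]=\{U : U\in\mathcal{F},\ S\subset U\}$ (here $\subset$ allows equality). For real $b>0$, the family $\mathcal{F}$ satisfies the $\Gamma(b)$-condition if $|\mathcal{F}[S]|<b^{-|S|}|\mathcal{F}|$ for every nonempty set $S\subset X$. *)

theory Defs
  imports Complex_Main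
begin

definition subfamily :: "'a set set \<Rightarrow> 'a set \<Rightarrow> 'a set set" where
  "subfamily F S = {U \<in> F. S \<subseteq> U}"

definition Gamma_condition :: "'a set \<Rightarrow> real \<Rightarrow> 'a set set \<Rightarrow> bool" where
  "Gamma_condition X b F \<longleftrightarrow>
     (\<forall>S. S \<subseteq> X \<and> S \<noteq> {} \<longrightarrow>
        real (card (subfamily F S)) < b powi (- int (card S)) * real (card F))"

end

theory Submission
  imports Defs "HOL-Library.FuncSet"
begin

text \<open>
  The idea is to colour the points of the ground set \<open>X\<close> independently and uniformly at random
  with \<open>k * L\<close> colours, where \<open>L\<close> is about \<open>log 2 m\<close>, and to give \<open>L\<close> of the colours to each
  of \<open>k\<close> players. If a player finds a member of the family all of whose points carry his own
  colours with probability greater than \<open>1 - 1 / k\<close>, then some colouring serves all players at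
  once, and the sets they find are disjoint.

  A player uncovers his colour classes one after the other. Let \<open>W\<close> be such a class and let
  \<open>T i\<close> be the indexed sets that he still has to cover, of size below \<open>2 * w\<close>. An index \<open>i\<close> is
  good if some \<open>T j\<close> inside \<open>W \<union> T i\<close> has fewer than \<open>w\<close> points outside \<open>W\<close>; then \<open>T i\<close> is
  replaced by \<open>T j - W\<close>. This is a subset of the old \<open>T i\<close>, so the new sets are at least
  as spread as the old ones, they have fewer than \<open>w\<close> points, and covering one of them later
  covers some \<open>T j\<close>. After \<open>L\<close> classes every surviving set is empty, that is, covered.

  There are few bad indices by the counting argument of Alweiss, Lovett, Wu and Zhang in the form
  given by Rao (lemma \<open>weighted_bad_count_le\<close>). A bad pair \<open>(W, i)\<close> is recovered from the
  union \<open>Z = W \<union> T i\<close>, from the large set \<open>A = T i \<inter> T j\<close>, where \<open>T j\<close> depends on \<open>Z\<close>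
  only, from \<open>i\<close> and from \<open>Z - W \<subseteq> T i\<close>. Spreadness makes the indices \<open>i\<close> with
  \<open>A \<subseteq> T i\<close> rare. Every class thus loses in expectation at most \<open>16 * (k * L)\<^sup>2 / b\<close> times
  the original number of indices, and the total loss is \<open>L\<close> times as much (lemma \<open>missing_bound\<close>).

  Altogether \<open>b > 16 * (k * L) ^ 3\<close> suffices (lemma \<open>disjoint_members_of_spread_family\<close>). The
  \<open>b\<close> of the theorem is at least \<open>c * sqrt m\<close>, whereas \<open>k\<close> and \<open>L\<close> are at most of order
  \<open>log 2 m\<close>, so the condition holds with much room to spare.
\<close>

section \<open>Few indices are bad\<close>

text \<open>
  The sets are indexed because distinct members may have the same remainder after a colour class
  is removed. The scale \<open>K\<close> is a parameter, rather than \<open>card I\<close>, so that discarding indices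
  preserves the property.
\<close>

definition spread :: "real \<Rightarrow> real \<Rightarrow> 'i set \<Rightarrow> ('i \<Rightarrow> 'a set) \<Rightarrow> bool" where
  "spread K b I T \<longleftrightarrow> (\<forall>A. finite A \<longrightarrow> real (card {i \<in> I. A \<subseteq> T i}) \<le> K / b ^ card A)"

definition bad :: "nat \<Rightarrow> 'i set \<Rightarrow> ('i \<Rightarrow> 'a set) \<Rightarrow> 'a set \<Rightarrow> 'i set" where
  "bad w I T W = {i \<in> I. \<forall>j\<in>I. T j \<subseteq> W \<union> T i \<longrightarrow> w \<le> card (T j - W)}"

lemma spread_shrink:
  assumes "spread K b I T" "finite I" "J \<subseteq> I" "\<And>i. i \<in> J \<Longrightarrow> T' i \<subseteq> T i"
  shows "spread K b J T'"
  unfolding spread_def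
proof (intro allI impI)
  fix A :: "'b set"
  assume "finite A"
  have "card {i \<in> J. A \<subseteq> T' i} \<le> card {i \<in> I. A \<subseteq> T i}"
    using assms by (intro card_mono) auto
  also have "real \<dots> \<le> K / b ^ card A"
    using assms(1) \<open>finite A\<close> by (auto simp: spread_def)
  finally show "real (card {i \<in> J. A \<subseteq> T' i}) \<le> K / b ^ card A" by simp
qed

lemma sum_Pow_power_card_Diff:
  fixes q :: real
  assumes "finite X"
  shows "(\<Sum>Z\<in>Pow X. q ^ card (X - Z)) = (q + 1) ^ card X"
proof -
  have "(q + 1) ^ card X = (\<Prod>x\<in>X. 1 + q)"
    by (simp add: add.commute)
  also have "\<dots> = (\<Sum>Z\<in>Pow X. (\<Prod>x\<in>Z. 1) * (\<Prod>x\<in>X - Z. q))"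
    by (rule prod_add[OF assms])
  finally show ?thesis by simp
qed

text \<open>
  All bad pairs with union \<open>Z\<close> are compared with one and the same member \<open>T j\<close> of \<open>Z\<close>.
  Badness of \<open>i\<close> says that \<open>T j\<close> has at least \<open>w\<close> points outside \<open>W\<close>, and these lie in
  \<open>T i\<close>. So \<open>A = T i \<inter> T j\<close> is one of at most \<open>2 ^ M\<close> subsets of \<open>T j\<close>, spreadness leaves
  at most \<open>K / b ^ w\<close> indices \<open>i\<close> for it, and \<open>Z - W\<close> is one of at most \<open>2 ^ M\<close> subsets of
  \<open>T i\<close>.
\<close>

lemma card_bad_pairs_with_union_le:
  fixes T :: "'i \<Rightarrow> 'a set"
  assumes "finite I" and T: "\<And>i. i \<in> I \<Longrightarrow> finite (T i) \<and> card (T i) \<le> M"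
    and "spread K b I T" "b \<ge> 1" "K \<ge> 0"
  shows "real (card {(W, i). i \<in> bad w I T W \<and> W \<union> T i = Z}) \<le> 4 ^ M * (K / b ^ w)"
proof (cases "\<exists>j\<in>I. T j \<subseteq> Z")
  case False
  then have "{(W, i). i \<in> bad w I T W \<and> W \<union> T i = Z} = {}"
    by (auto simp: bad_def)
  then show ?thesis
    using assms(4,5) by (simp only:) simp
next
  case True
  then obtain j where j: "j \<in> I" "T j \<subseteq> Z" by blast
  define As where "As = {A \<in> Pow (T j). w \<le> card A}"
  have finAs: "finite As" and cardAs: "card As \<le> 2 ^ M"
  proof -
    show "finite As" using T[OF j(1)] by (simp add: As_def)
    have "card As \<le> card (Pow (T j))"
      using T[OF j(1)] by (intro card_mono) (auto simp: As_def)
    also have "\<dots> \<le> 2 ^ M"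
      using T[OF j(1)] by (simp add: card_Pow)
    finally show "card As \<le> 2 ^ M" .
  qed
  define Q where "Q A = Sigma {i \<in> I. A \<subseteq> T i} (\<lambda>i. Pow (T i))" for A
  have finQ: "finite (Q A)" for A
    using assms(1) T by (auto simp: Q_def)
  have cardQ: "real (card (Q A)) \<le> 2 ^ M * (K / b ^ w)" if "A \<in> As" for A
  proof -
    have "finite A"
      using that T[OF j(1)] by (auto simp: As_def intro: finite_subset)
    have "real (card (Q A)) = (\<Sum>i\<in>{i \<in> I. A \<subseteq> T i}. real (card (Pow (T i))))"
      using assms(1) T by (simp add: Q_def)
    also have "\<dots> \<le> real (card {i \<in> I. A \<subseteq> T i}) * 2 ^ M"
      using T by (intro sum_bounded_above) (auto simp: card_Pow)
    also have "\<dots> \<le> K / b ^ card A * 2 ^ M"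
      using assms(3) \<open>finite A\<close> by (intro mult_right_mono) (auto simp: spread_def)
    also have "\<dots> \<le> K / b ^ w * 2 ^ M"
      using that assms by (intro mult_right_mono divide_left_mono power_increasing)
        (auto simp: As_def)
    finally show ?thesis by (simp add: mult.commute)
  qed
  have "{(W, i). i \<in> bad w I T W \<and> W \<union> T i = Z} \<subseteq> (\<lambda>(i, B). (Z - B, i)) ` (\<Union>A\<in>As. Q A)"
  proof
    fix p assume "p \<in> {(W, i). i \<in> bad w I T W \<and> W \<union> T i = Z}"
    then obtain W i where p: "p = (W, i)" and i: "i \<in> bad w I T W" and Z: "Z = W \<union> T i"
      by blast
    have iI: "i \<in> I" using i by (simp add: bad_def)
    have "w \<le> card (T j - W)"
      using i j Z by (auto simp: bad_def)
    also have "\<dots> \<le> card (T i \<inter> T j)"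
      using T[OF iI] j Z by (intro card_mono) auto
    finally have "T i \<inter> T j \<in> As" by (auto simp: As_def)
    moreover have "(i, Z - W) \<in> Q (T i \<inter> T j)"
      using iI Z by (auto simp: Q_def)
    moreover have "W = Z - (Z - W)"
      using Z by auto
    ultimately show "p \<in> (\<lambda>(i, B). (Z - B, i)) ` (\<Union>A\<in>As. Q A)"
      unfolding p by (intro image_eqI[of _ _ "(i, Z - W)"]) auto
  qed
  then have "card {(W, i). i \<in> bad w I T W \<and> W \<union> T i = Z} \<le> card (\<Union>A\<in>As. Q A)"
    using finAs finQ by (intro surj_card_le) auto
  also have "\<dots> \<le> (\<Sum>A\<in>As. card (Q A))"
    by (rule card_UN_le[OF finAs])
  finally have "real (card {(W, i). i \<in> bad w I T W \<and> W \<union> T i = Z}) \<le> (\<Sum>A\<in>As. real (card (Q A)))"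
    by (simp only: of_nat_le_iff flip: of_nat_sum)
  also have "\<dots> \<le> real (card As) * (2 ^ M * (K / b ^ w))"
    using cardQ by (rule sum_bounded_above)
  also have "\<dots> \<le> 2 ^ M * (2 ^ M * (K / b ^ w))"
    using cardAs assms(4,5) by (intro mult_right_mono) (simp_all add: numeral_power_eq_of_nat_cancel_iff)
  also have "\<dots> = 4 ^ M * (K / b ^ w)"
    by (simp flip: power_mult_distrib)
  finally show ?thesis .
qed

text \<open>
  The weight \<open>q ^ card (X - W)\<close> is the number of colourings of \<open>X\<close> with \<open>q + 1\<close> colours that
  have \<open>W\<close> as a given colour class. Passing from \<open>W\<close> to \<open>W \<union> T i\<close> changes it by a factor
  of at most \<open>(q + 1) ^ M\<close>, which lets the sum be taken over the unions instead.
\<close>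

lemma weighted_bad_count_le:
  fixes T :: "'i \<Rightarrow> 'a set"
  assumes "finite X" "finite I" and T: "\<And>i. i \<in> I \<Longrightarrow> T i \<subseteq> X \<and> card (T i) \<le> M"
    and "spread K b I T" "b \<ge> 1" "K \<ge> 0" "q \<ge> 0"
  shows "(\<Sum>W\<in>Pow X. q ^ card (X - W) * real (card (bad w I T W)))
           \<le> (4 * (q + 1)) ^ M * (K / b ^ w) * (q + 1) ^ card X"
proof -
  have finT: "finite (T i) \<and> card (T i) \<le> M" if "i \<in> I" for i
    using T[OF that] assms(1) finite_subset by blast
  have bI: "bad w I T W \<subseteq> I" for W by (auto simp: bad_def)
  have finbad: "finite (bad w I T W)" for W
    using bI assms(2) finite_subset by blast
  define P where "P = Sigma (Pow X) (bad w I T)"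
  have finP: "finite P"
    using assms(1) finbad by (simp add: P_def)
  have "(\<Sum>W\<in>Pow X. q ^ card (X - W) * real (card (bad w I T W)))
          = (\<Sum>W\<in>Pow X. \<Sum>i\<in>bad w I T W. q ^ card (X - W))"
    by (simp add: mult.commute)
  also have "\<dots> = (\<Sum>(W, i)\<in>P. q ^ card (X - W))"
    unfolding P_def using assms(1) finbad by (subst sum.Sigma) auto
  also have "\<dots> = (\<Sum>Z\<in>Pow X. \<Sum>(W, i)\<in>{p \<in> P. (\<lambda>(W, i). W \<union> T i) p = Z}. q ^ card (X - W))"
    using finP assms(1) bI T by (subst sum.group) (fastforce simp: P_def)+
  also have "\<dots> \<le> (\<Sum>Z\<in>Pow X. 4 ^ M * (K / b ^ w) * (q ^ card (X - Z) * (q + 1) ^ M))"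
  proof (rule sum_mono)
    fix Z assume "Z \<in> Pow X"
    then have Z: "Z \<subseteq> X" by simp
    define PZ where "PZ = {p \<in> P. (\<lambda>(W, i). W \<union> T i) p = Z}"
    have PZ: "PZ = {(W, i). i \<in> bad w I T W \<and> W \<union> T i = Z}"
      using Z by (auto simp: PZ_def P_def)
    have "(case p of (W, i) \<Rightarrow> q ^ card (X - W)) \<le> q ^ card (X - Z) * (q + 1) ^ M"
      if "p \<in> PZ" for p
    proof -
      obtain W i where p: "p = (W, i)" by force
      then have i: "i \<in> I" and WZ: "W \<union> T i = Z"
        using that bI by (auto simp: PZ)
      have "X - W = (X - Z) \<union> (Z - W)" using WZ Z by auto
      then have "card (X - W) = card (X - Z) + card (Z - W)"
        using assms(1) Z
        by (simp only:) (rule card_Un_disjoint, auto intro: finite_subset)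
      then have "q ^ card (X - W) = q ^ card (X - Z) * q ^ card (Z - W)"
        by (simp add: power_add)
      moreover have "q ^ card (Z - W) \<le> (q + 1) ^ M"
      proof -
        have "card (Z - W) \<le> card (T i)"
          using finT[OF i] WZ by (intro card_mono) auto
        then have "card (Z - W) \<le> M"
          using finT[OF i] by simp
        have "q ^ card (Z - W) \<le> (q + 1) ^ card (Z - W)"
          using assms(7) by (intro power_mono) auto
        also have "\<dots> \<le> (q + 1) ^ M"
          using assms(7) \<open>card (Z - W) \<le> M\<close> by (intro power_increasing) auto
        finally show ?thesis .
      qed
      ultimately show ?thesis
        using assms(7) p by (simp add: mult_left_mono)
    qed
    then have "(\<Sum>(W, i)\<in>PZ. q ^ card (X - W)) \<le> real (card PZ) * (q ^ card (X - Z) * (q + 1) ^ M)"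
      by (rule sum_bounded_above)
    also have "\<dots> \<le> 4 ^ M * (K / b ^ w) * (q ^ card (X - Z) * (q + 1) ^ M)"
      unfolding PZ using assms finT
      by (intro mult_right_mono card_bad_pairs_with_union_le) auto
    finally show "(\<Sum>(W, i)\<in>{p \<in> P. (\<lambda>(W, i). W \<union> T i) p = Z}. q ^ card (X - W))
        \<le> 4 ^ M * (K / b ^ w) * (q ^ card (X - Z) * (q + 1) ^ M)"
      by (simp add: PZ_def)
  qed
  also have "\<dots> = 4 ^ M * (K / b ^ w) * (q + 1) ^ M * (\<Sum>Z\<in>Pow X. q ^ card (X - Z))"
    unfolding sum_distrib_left by (intro sum.cong) (simp_all only: mult_ac)
  also have "\<dots> = (4 * (q + 1)) ^ M * (K / b ^ w) * (q + 1) ^ card X"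
    unfolding sum_Pow_power_card_Diff[OF assms(1)] power_mult_distrib by (simp add: mult_ac)
  finally show ?thesis .
qed

section \<open>Random colourings cover a member of a spread family\<close>

definition missing :: "'a set \<Rightarrow> 'c set \<Rightarrow> 'c set \<Rightarrow> 'i set \<Rightarrow> ('i \<Rightarrow> 'a set) \<Rightarrow> ('a \<Rightarrow> 'c) set" where
  "missing X C D I T = {g \<in> X \<rightarrow>\<^sub>E C. \<forall>i\<in>I. \<not> g ` T i \<subseteq> D}"

lemma finite_missing: "finite X \<Longrightarrow> finite C \<Longrightarrow> finite (missing X C D I T)"
  unfolding missing_def by (rule finite_subset[OF _ finite_PiE]) auto

lemma card_missing_le:
  assumes "finite X" "finite C"
  shows "card (missing X C D I T) \<le> card C ^ card X"
proof -
  have "card (missing X C D I T) \<le> card (X \<rightarrow>\<^sub>E C)"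
    using assms by (intro card_mono finite_PiE) (auto simp: missing_def)
  then show ?thesis
    using assms(1) by (simp add: card_PiE)
qed

text \<open>
  Once the colour class \<open>W\<close> of \<open>c\<close> is known, the rest of the colouring is a uniform colouring of
  \<open>X - W\<close> with the other colours. A set \<open>T' W i\<close> covered by it, together with \<open>W\<close>, covers
  some \<open>T j\<close>.
\<close>

lemma card_missing_insert_le:
  assumes "finite X" "finite C" "c \<in> C" "c \<notin> D"
    and T': "\<And>W i. W \<subseteq> X \<Longrightarrow> i \<in> J W \<Longrightarrow> \<exists>j\<in>I. T j \<subseteq> X \<and> T' W i = T j - W"
  shows "card (missing X C (insert c D) I T)
           \<le> (\<Sum>W\<in>Pow X. card (missing (X - W) (C - {c}) D (J W) (T' W)))"
proof -
  define cls where "cls g = {x \<in> X. g x = c}" for g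
  let ?S = "Sigma (Pow X) (\<lambda>W. missing (X - W) (C - {c}) D (J W) (T' W))"
  let ?f = "\<lambda>g. (cls g, restrict g (X - cls g))"
  have fin: "finite ?S"
    using assms by (auto intro: finite_missing)
  have "inj_on ?f (X \<rightarrow>\<^sub>E C)"
  proof (rule inj_onI)
    fix g h assume gh: "g \<in> X \<rightarrow>\<^sub>E C" "h \<in> X \<rightarrow>\<^sub>E C" "?f g = ?f h"
    show "g = h"
    proof (rule PiE_ext[OF gh(1,2)])
      fix x assume x: "x \<in> X"
      have eq: "cls g = cls h" using gh(3) by simp
      have "restrict g (X - cls g) x = restrict h (X - cls h) x"
        using gh(3) by (metis prod.inject)
      show "g x = h x"
      proof (cases "x \<in> cls g")
        case True
        then show ?thesis using eq by (metis (mono_tags, lifting) cls_def mem_Collect_eq)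
      next
        case False
        then show ?thesis
          using eq x \<open>restrict g (X - cls g) x = restrict h (X - cls h) x\<close> by simp
      qed
    qed
  qed
  then have "inj_on ?f (missing X C (insert c D) I T)"
    by (rule inj_on_subset) (auto simp: missing_def)
  moreover have "?f ` missing X C (insert c D) I T \<subseteq> ?S"
  proof (rule image_subsetI)
    fix g assume g: "g \<in> missing X C (insert c D) I T"
    have sub: "cls g \<subseteq> X" by (auto simp: cls_def)
    have "\<not> restrict g (X - cls g) ` T' (cls g) i \<subseteq> D" if i: "i \<in> J (cls g)" for i
    proof
      assume *: "restrict g (X - cls g) ` T' (cls g) i \<subseteq> D"
      obtain j where j: "j \<in> I" "T j \<subseteq> X" "T' (cls g) i = T j - cls g"
        using T'[OF sub i] by blast
      have "g x \<in> insert c D" if "x \<in> T j" for x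
      proof (cases "x \<in> cls g")
        case False
        then have "restrict g (X - cls g) x \<in> D"
          using * j(3) that by blast
        then show ?thesis using False that j(2) by auto
      qed (simp add: cls_def)
      then show False using g j(1) by (auto simp: missing_def)
    qed
    moreover have "restrict g (X - cls g) \<in> (X - cls g) \<rightarrow>\<^sub>E (C - {c})"
      using g by (auto simp: missing_def cls_def)
    ultimately show "?f g \<in> ?S"
      using sub by (auto simp: missing_def)
  qed
  ultimately have "card (missing X C (insert c D) I T) \<le> card ?S"
    using fin by (rule card_inj_on_le)
  then show ?thesis
    using assms by (simp add: finite_missing)
qed

text \<open>
  Induction on the set \<open>D\<close> of available colours, one colour class halving the sizes. Bounding the
  product of \<open>card I\<close> and the failure count, instead of the failure count, makes the losses add
  up: the bad indices contribute at most their number times the number of all colourings, and the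
  good ones are covered by the induction hypothesis, whose bound does not depend on how many of
  them there are.
\<close>

lemma missing_bound:
  fixes T :: "'i \<Rightarrow> 'a set" and C D :: "'c set"
  assumes "finite D" "finite X" "finite C" "card C \<le> N" "D \<subseteq> C" "finite I"
    and "\<And>i. i \<in> I \<Longrightarrow> T i \<subseteq> X \<and> card (T i) < 2 ^ card D"
    and "spread K b I T" "K \<ge> 0" "16 * (real N)\<^sup>2 \<le> b" "N \<ge> 1"
  shows "real (card I) * real (card (missing X C D I T))
           \<le> real (card D) * (16 * (real N)\<^sup>2 / b) * K * real (card C) ^ card X"
  using assms
proof (induction D arbitrary: X C I T rule: finite_induct)
  case empty
  have "T i = {}" if "i \<in> I" for i
    using empty.prems(1,6) that by (metis card.empty card_eq_0_iff finite_subset less_one power_0)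
  then have "I = {} \<or> missing X C {} I T = {}"
    by (auto simp: missing_def)
  then show ?case by auto
next
  case (insert c D)
  note X = insert.prems(1) and C = insert.prems(2) and I = insert.prems(5)
    and T = insert.prems(6) and sp = insert.prems(7) and K = insert.prems(8)
    and b = insert.prems(9)
  define w :: nat where "w = 2 ^ card D"
  define \<delta> where "\<delta> = 16 * (real N)\<^sup>2 / b"
  define q where "q = real (card (C - {c}))"
  have c: "c \<in> C" and q1: "q + 1 = real (card C)"
    using insert.prems(4) card_Suc_Diff1[OF C, of c] by (auto simp: q_def)
  have "1 \<le> 16 * (real N)\<^sup>2"
    using insert.prems(10) one_le_power[of "real N" 2] by linarith
  then have b1: "b \<ge> 1" and \<delta>1: "0 \<le> \<delta>" "\<delta> \<le> 1"
    using b by (auto simp: \<delta>_def)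
  have finbad: "finite (bad w I T W)" "bad w I T W \<subseteq> I" for W
    using I by (auto simp: bad_def)
  define J where "J W = I - bad w I T W" for W
  have "\<exists>j. \<forall>W. \<forall>i\<in>J W. j W i \<in> I \<and> T (j W i) \<subseteq> W \<union> T i \<and> card (T (j W i) - W) < w"
    by (intro choice allI) (auto simp: J_def bad_def not_le Bex_def intro!: bchoice)
  then obtain j where j: "\<And>W i. i \<in> J W \<Longrightarrow>
      j W i \<in> I \<and> T (j W i) \<subseteq> W \<union> T i \<and> card (T (j W i) - W) < w"
    by blast
  define T' where "T' W i = T (j W i) - W" for W i
  define f where "f W = real (card (missing (X - W) (C - {c}) D (J W) (T' W)))" for W
  have IH: "real (card (J W)) * f W \<le> real (card D) * \<delta> * K * q ^ card (X - W)" if "W \<subseteq> X" for W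
    unfolding f_def \<delta>_def q_def
  proof (rule insert.IH)
    show "T' W i \<subseteq> X - W \<and> card (T' W i) < 2 ^ card D" if "i \<in> J W" for i
      using j[OF that] T by (auto simp: T'_def w_def)
    show "spread K b (J W) (T' W)"
      using sp I by (rule spread_shrink) (use j in \<open>auto simp: J_def T'_def\<close>)
    show "card (C - {c}) \<le> N"
      using insert.prems(2,3) by (meson card_Diff1_le le_trans)
  qed (use insert in \<open>auto simp: J_def\<close>)
  have fq: "f W \<le> q ^ card (X - W)" for W
    unfolding f_def q_def
    using card_missing_le[of "X - W" "C - {c}"] X C by (metis finite_Diff of_nat_le_iff of_nat_power)
  have split: "real (card I) * f W
      \<le> q ^ card (X - W) * real (card (bad w I T W)) + real (card D) * \<delta> * K * q ^ card (X - W)"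
    if "W \<subseteq> X" for W
  proof -
    have "card I = card (bad w I T W) + card (J W)"
      unfolding J_def using finbad I by (metis card_Diff_subset card_mono le_add_diff_inverse)
    then have "real (card I) * f W = f W * real (card (bad w I T W)) + real (card (J W)) * f W"
      by (simp add: algebra_simps)
    then show ?thesis
      using IH[OF that] mult_right_mono[OF fq[of W], of "real (card (bad w I T W))"] by simp
  qed
  have bad_count: "(\<Sum>W\<in>Pow X. q ^ card (X - W) * real (card (bad w I T W)))
      \<le> \<delta> * K * (q + 1) ^ card X"
  proof -
    have small: "(4 * (q + 1)) ^ (2 * w) * (K / b ^ w) \<le> \<delta> * K"
    proof -
      have "(4 * (q + 1)) ^ (2 * w) \<le> (4 * real N) ^ (2 * w)"
        unfolding q1 using insert.prems(3) by (intro power_mono) auto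
      then have "(4 * (q + 1)) ^ (2 * w) * (K / b ^ w) \<le> (4 * real N) ^ (2 * w) * (K / b ^ w)"
        using K b1 by (intro mult_right_mono) auto
      also have "\<dots> = \<delta> ^ w * K"
        by (simp add: \<delta>_def power_mult power_divide power_mult_distrib)
      also have "\<dots> \<le> \<delta> ^ 1 * K"
        using \<delta>1 K by (intro mult_right_mono power_decreasing) (auto simp: w_def)
      finally show ?thesis by simp
    qed
    have "(\<Sum>W\<in>Pow X. q ^ card (X - W) * real (card (bad w I T W)))
        \<le> (4 * (q + 1)) ^ (2 * w) * (K / b ^ w) * (q + 1) ^ card X"
      using X I _ sp b1 K
      by (rule weighted_bad_count_le) (use T insert.hyps in \<open>auto simp: w_def q_def less_imp_le\<close>)
    also have "\<dots> \<le> \<delta> * K * (q + 1) ^ card X"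
      using small by (intro mult_right_mono) (auto simp: q_def)
    finally show ?thesis .
  qed
  have "real (card (missing X C (insert c D) I T)) \<le> (\<Sum>W\<in>Pow X. f W)"
    unfolding f_def of_nat_sum[symmetric] of_nat_le_iff
    using X C c insert.hyps(2)
    by (rule card_missing_insert_le) (use j T in \<open>auto simp: T'_def\<close>)
  then have "real (card I) * real (card (missing X C (insert c D) I T))
      \<le> real (card I) * (\<Sum>W\<in>Pow X. f W)"
    by (intro mult_left_mono) auto
  also have "\<dots> = (\<Sum>W\<in>Pow X. real (card I) * f W)"
    by (simp add: sum_distrib_left)
  also have "\<dots> \<le> (\<Sum>W\<in>Pow X. q ^ card (X - W) * real (card (bad w I T W))
      + real (card D) * \<delta> * K * q ^ card (X - W))"
    using split by (intro sum_mono) auto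
  also have "\<dots> = (\<Sum>W\<in>Pow X. q ^ card (X - W) * real (card (bad w I T W)))
      + real (card D) * \<delta> * K * (q + 1) ^ card X"
    unfolding sum_Pow_power_card_Diff[OF X, symmetric] by (simp add: sum.distrib sum_distrib_left)
  also have "\<dots> \<le> \<delta> * K * (q + 1) ^ card X + real (card D) * \<delta> * K * (q + 1) ^ card X"
    using bad_count by simp
  finally show ?case
    unfolding q1 \<delta>_def[symmetric] card_insert_disjoint[OF insert.hyps(1,2)] of_nat_Suc
    by (simp add: algebra_simps)
qed

section \<open>Disjoint members\<close>

text \<open>
  The colours are pairs; player \<open>a\<close> owns those with first component \<open>a\<close>. By
  \<open>missing_bound\<close> each player fails on a fraction of at most \<open>16 * k\<^sup>2 * L ^ 3 / b\<close> of the
  colourings, so the hypothesis on \<open>b\<close> is what the union bound over \<open>k\<close> players needs.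
\<close>

lemma disjoint_members_of_spread_family:
  fixes F :: "'a set set"
  assumes "finite X" "F \<subseteq> Pow X" "F \<noteq> {}" "{} \<notin> F" and small: "\<And>U. U \<in> F \<Longrightarrow> card U < 2 ^ L"
    and sp: "spread (real (card F)) b F (\<lambda>U. U)" and b: "16 * (real k * real L) ^ 3 < b" "k \<ge> 1"
  shows "\<exists>G\<subseteq>F. card G = k \<and> pairwise disjnt G"
proof -
  define N where "N = k * L"
  define C where "C = {..<k} \<times> {..<L}"
  define D where "D a = {a} \<times> {..<L}" for a :: nat
  define M where "M a = missing X C (D a) F (\<lambda>U. U)" for a
  have finF: "finite F" using assms(1,2) finite_subset by blast
  have finC: "finite C" and cardC: "card C = N" by (auto simp: C_def N_def)
  have "L \<noteq> 0"
  proof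
    assume "L = 0"
    then obtain U where "U \<in> F" "card U = 0" using assms(3) small by fastforce
    then show False using assms(1,2,4) by (metis PowD card_0_eq finite_subset subsetD)
  qed
  then have N1: "N \<ge> 1" using b(2) by (simp add: N_def)
  have b16: "16 * real N ^ 3 < b" using b(1) by (simp add: N_def)
  have "real N ^ 2 \<le> real N ^ 3" using N1 by (intro power_increasing) auto
  then have b2: "16 * (real N)\<^sup>2 \<le> b" using b16 by linarith
  have bpos: "b > 0" using b16 by (rule le_less_trans[rotated]) simp
  define n where "n = real N ^ card X"
  have npos: "n > 0" using N1 by (simp add: n_def)
  have "k * (L * (16 * (real N)\<^sup>2 / b)) = 16 * real N ^ 3 / b"
    by (simp add: N_def power2_eq_square power3_eq_cube)
  also have "\<dots> < 1" using b16 bpos by simp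
  finally have loss: "k * (L * (16 * (real N)\<^sup>2 / b)) < 1" .
  have "real (card (M a)) \<le> real L * (16 * (real N)\<^sup>2 / b) * n" if "a < k" for a
  proof -
    have "real (card F) * real (card (M a))
        \<le> real (card (D a)) * (16 * (real N)\<^sup>2 / b) * real (card F) * real (card C) ^ card X"
      unfolding M_def using assms(1) finC
      by (intro missing_bound) (use that assms small finF sp b2 N1 cardC in \<open>auto simp: D_def C_def\<close>)
    then have "real (card F) * real (card (M a))
        \<le> real (card F) * (real L * (16 * (real N)\<^sup>2 / b) * n)"
      by (simp add: D_def cardC n_def mult_ac)
    moreover have "real (card F) > 0" using finF assms(3) by (simp add: card_gt_0_iff)
    ultimately show ?thesis by (simp only: mult_le_cancel_left_pos)
  qed
  then have "(\<Sum>a<k. real (card (M a))) \<le> real (card {..<k}) * (real L * (16 * (real N)\<^sup>2 / b) * n)"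
    by (intro sum_bounded_above) auto
  also have "\<dots> = k * (L * (16 * (real N)\<^sup>2 / b)) * n" by simp
  also have "\<dots> < 1 * n" using loss npos by (rule mult_strict_right_mono)
  also have "1 * n = n" by simp
  also have "n = real (card (X \<rightarrow>\<^sub>E C))"
    using assms(1) by (simp add: n_def card_PiE cardC)
  finally have "(\<Sum>a<k. card (M a)) < card (X \<rightarrow>\<^sub>E C)"
    by (simp flip: of_nat_sum)
  moreover have "card (\<Union>a<k. M a) \<le> (\<Sum>a<k. card (M a))"
    by (rule card_UN_le) simp
  moreover have "finite (\<Union>a<k. M a)"
    using assms(1) finC by (auto simp: M_def intro: finite_missing)
  ultimately have "\<not> (X \<rightarrow>\<^sub>E C) \<subseteq> (\<Union>a<k. M a)"
    using card_mono[of "\<Union>a<k. M a" "X \<rightarrow>\<^sub>E C"] by linarith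
  then obtain g where g: "g \<in> X \<rightarrow>\<^sub>E C" "\<forall>a<k. g \<notin> M a" by blast
  then have "\<forall>a\<in>{..<k}. \<exists>U\<in>F. g ` U \<subseteq> D a"
    by (auto simp: M_def missing_def)
  then obtain U where U: "\<And>a. a < k \<Longrightarrow> U a \<in> F \<and> g ` U a \<subseteq> D a"
    by (metis lessThan_iff)
  have disj: "U a \<inter> U a' = {}" if "a < k" "a' < k" "a \<noteq> a'" for a a'
    using U[OF that(1)] U[OF that(2)] that(3) by (fastforce simp: D_def)
  have "inj_on U {..<k}"
  proof (rule inj_onI)
    fix a a' assume "a \<in> {..<k}" "a' \<in> {..<k}" "U a = U a'"
    then show "a = a'" using disj[of a a'] U assms(4) by force
  qed
  then have "card (U ` {..<k}) = k" by (simp add: card_image)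
  moreover have "pairwise disjnt (U ` {..<k})"
    using disj by (auto simp: pairwise_def disjnt_def)
  moreover have "U ` {..<k} \<subseteq> F" using U by auto
  ultimately show ?thesis by blast
qed

lemma spread_if_Gamma_condition:
  assumes "F \<subseteq> Pow X" "Gamma_condition X b F" "b > 0"
  shows "spread (real (card F)) b F (\<lambda>U. U)"
  unfolding spread_def
proof (intro allI impI)
  fix A :: "'a set"
  assume "finite A"
  consider "A = {}" | "A \<noteq> {}" "A \<subseteq> X" | "\<not> A \<subseteq> X" by blast
  then show "real (card {U \<in> F. A \<subseteq> U}) \<le> real (card F) / b ^ card A"
  proof cases
    case 2
    then have "real (card (subfamily F A)) < b powi (- int (card A)) * real (card F)"
      using assms(2) by (simp add: Gamma_condition_def)
    then show ?thesis
      using assms(3) by (simp add: subfamily_def power_int_minus field_simps)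
  next
    case 3
    then have "{U \<in> F. A \<subseteq> U} = {}" using assms(1) by auto
    then show ?thesis using assms(3) by (simp only:) simp
  qed simp
qed

text \<open>
  Writing \<open>y = x / 8\<close>, this is the fourth power of \<open>y \<le> 2 powr y\<close>.
\<close>

lemma fourth_power_le_powr:
  fixes x :: real
  assumes "x \<ge> 0"
  shows "x ^ 4 \<le> 4096 * 2 powr (x / 2)"
proof -
  define n where "n = nat \<lfloor>x / 8\<rfloor>"
  have n: "real n \<le> x / 8" "x / 8 < real n + 1"
    using assms unfolding n_def by linarith+
  have "x / 8 \<le> real (Suc n)" using n by simp
  also have "real (Suc n) \<le> 2 ^ n"
    using of_nat_less_two_power[of n, where 'a = real] by (metis Suc_leI less_exp of_nat_le_iff
        of_nat_numeral of_nat_power)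
  also have "(2::real) ^ n = 2 powr real n" by (simp add: powr_realpow)
  also have "\<dots> \<le> 2 powr (x / 8)" using n by simp
  finally have "(x / 8) ^ 4 \<le> (2 powr (x / 8)) ^ 4"
    using assms by (intro power_mono) auto
  also have "(2 powr (x / 8)) ^ 4 = 2 powr (x / 2)"
    by (simp add: powr_power)
  finally show ?thesis by (simp add: power_divide)
qed

text \<open>
  The hypothesis on \<open>m\<close> gives \<open>k < log 2 m\<close>, so \<open>k\<^sup>2 * (log 2 m)\<^sup>2 \<le> (log 2 m) ^ 4\<close>, which
  is at most \<open>4096 * sqrt m\<close>.
\<close>

lemma spread_parameter_large:
  fixes k m :: nat
  assumes "k > 1" "real m > 2 powr (2 ^ 20 * real k)"
    and L: "real L \<le> 2 * log 2 (real m)"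
  shows "16 * (real k * real L) ^ 3
    < 2 ^ 20 * 2 powr (5 / 2 * sqrt (log 2 (real m))) * (sqrt (real m) * log 2 (real m))
            * real k * log 2 (real k)"
proof -
  define x where "x = log 2 (real m)"
  have mpos: "real m > 0" using assms(2) by (rule le_less_trans[rotated]) simp
  have "2 ^ 20 * real k < x"
    unfolding x_def using assms(2) mpos by (simp add: less_log_iff)
  then have kx: "real k \<le> x" and xpos: "x > 0"
    using assms(1) by auto
  have "real m = 2 powr x" using mpos by (simp add: x_def)
  then have "sqrt (real m) = 2 powr (x / 2)"
    using powr_half_sqrt[of "real m"] by (simp add: powr_powr)
  then have sq: "x ^ 4 \<le> 4096 * sqrt (real m)"
    using fourth_power_le_powr[of x] xpos by simp
  have "(real k * real L) ^ 3 \<le> (real k * (2 * x)) ^ 3"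
    using L by (intro power_mono mult_left_mono) (auto simp: x_def)
  also have "\<dots> = 8 * (real k)\<^sup>2 * x\<^sup>2 * (real k * x)"
    by (simp add: power2_eq_square power3_eq_cube)
  also have "\<dots> \<le> 8 * x\<^sup>2 * x\<^sup>2 * (real k * x)"
    using kx xpos by (intro mult_mono power_mono) auto
  also have "\<dots> = 8 * x ^ 4 * (real k * x)"
    by (simp add: power4_eq_xxxx power2_eq_square)
  also have "\<dots> \<le> 8 * (4096 * sqrt (real m)) * (real k * x)"
    using sq xpos by (intro mult_mono) auto
  finally have "16 * (real k * real L) ^ 3 \<le> 2 ^ 19 * (sqrt (real m) * x * real k)"
    by (simp add: mult_ac)
  also have "\<dots> < 2 ^ 20 * (sqrt (real m) * x * real k)"
    using mpos xpos assms(1) by simp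
  also have "\<dots> \<le> 2 ^ 20 * (sqrt (real m) * x * real k)
      * (2 powr (5 / 2 * sqrt x) * log 2 (real k))"
  proof -
    have "1 \<le> 2 powr (5 / 2 * sqrt x)" using xpos by (intro ge_one_powr_ge_zero) auto
    moreover have "1 \<le> log 2 (real k)" using assms(1) by (simp add: le_log_iff)
    ultimately have "1 * 1 \<le> 2 powr (5 / 2 * sqrt x) * log 2 (real k)"
      by (intro mult_mono) auto
    moreover have "0 \<le> 2 ^ 20 * (sqrt (real m) * x * real k)" using xpos by simp
    ultimately show ?thesis by (metis mult.right_neutral mult_left_mono)
  qed
  finally show ?thesis by (simp add: x_def mult_ac)
qed

theorem theorem1p1:
  "\<exists>c::real. c > 1 \<and>
    (\<forall>(k::nat) (m::nat) (X::'a set) (F::'a set set).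
       k > 1 \<longrightarrow> real m > 2 powr (c * real k) \<longrightarrow>
       finite X \<longrightarrow> X \<noteq> {} \<longrightarrow> F \<subseteq> Pow X \<longrightarrow> (\<forall>U\<in>F. card U = m) \<longrightarrow>
       Gamma_condition X
         (c * 2 powr (5 / 2 * sqrt (log 2 (real m))) * (sqrt (real m) * log 2 (real m))
            * real k * log 2 (real k)) F \<longrightarrow>
       (\<exists>G\<subseteq>F. card G = k \<and> pairwise disjnt G))"
proof (intro exI[of _ "2 ^ 20"] conjI allI impI)
  fix k m :: nat and X :: "'a set" and F :: "'a set set"
  assume k: "k > 1" and m: "real m > 2 powr (2 ^ 20 * real k)"
    and X: "finite X" "X \<noteq> {}" and F: "F \<subseteq> Pow X" "\<forall>U\<in>F. card U = m"
    and \<Gamma>: "Gamma_condition X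
         (2 ^ 20 * 2 powr (5 / 2 * sqrt (log 2 (real m))) * (sqrt (real m) * log 2 (real m))
            * real k * log 2 (real k)) F"
  define b where "b = 2 ^ 20 * 2 powr (5 / 2 * sqrt (log 2 (real m)))
    * (sqrt (real m) * log 2 (real m)) * real k * log 2 (real k)"
  define L where "L = nat \<lfloor>log 2 (real m)\<rfloor> + 1"
  have "2 powr 1 \<le> (2::real) powr (2 ^ 20 * real k)" using k by (intro powr_mono) auto
  then have m2: "real m \<ge> 2" using m by simp
  then have "log 2 (real m) \<ge> 1" by (simp add: le_log_iff)
  then have L: "log 2 (real m) < real L" "real L \<le> 2 * log 2 (real m)"
    unfolding L_def by linarith+
  then have "real m < 2 powr real L" using m2 by (simp add: log_less_iff)
  then have mL: "m < 2 ^ L"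
    by (metis of_nat_less_iff of_nat_numeral of_nat_power powr_realpow zero_less_numeral)
  have b: "16 * (real k * real L) ^ 3 < b"
    unfolding b_def using k m L(2) by (rule spread_parameter_large)
  then have bpos: "b > 0" by (rule le_less_trans[rotated]) simp
  (* A one-point S makes the strict inequality of the condition fail for the empty family. *)
  obtain x where "x \<in> X" using X(2) by blast
  then have "real (card (subfamily F {x})) < b powi (- int (card {x})) * real (card F)"
    using \<Gamma> unfolding Gamma_condition_def b_def by blast
  then have "F \<noteq> {}" by (auto simp: subfamily_def)
  moreover have "{} \<notin> F" using F(2) m2 by force
  moreover have "spread (real (card F)) b F (\<lambda>U. U)"
    using F(1) \<Gamma> bpos unfolding b_def by (rule spread_if_Gamma_condition)
  ultimately show "\<exists>G\<subseteq>F. card G = k \<and> pairwise disjnt G"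
    using X(1) F mL b k by (intro disjoint_members_of_spread_family) auto
qed simp

end
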